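(* Let $A=(a_{ij})\in\hat{\mathbb H}^{n\times n}$ be a dual quaternion Hermitian matrix, let $\alpha\in\hat{\mathbb H}$, and for $i\in\{1,\dots,n\}$ let $P_{i;\alpha}$ be the multiplication matrix. Then $$\mathrm{Cdet}(P_{n;\alpha}A)=\alpha\,\mathrm{Cdet}(A),\qquad \mathrm{Cdet}(AP_{n;\alpha})=\alpha\,\mathrm{Cdet}(A),$$ and $$\mathrm{Cdet}(P_{i;\alpha}^*AP_{i;\alpha})=\alpha^*\alpha\,\mathrm{Cdet}(A)\qquad\text{for all } i=1,\dots,n,$$ where $\mathrm{Cdet}$ is the Chen determinant.
   Context: $\mathbb H$ denotes the real quaternions with conjugation $q\mapsto q^*$. A dual quaternion is $q=q_s+q_d\epsilon$ with $q_s,q_d\in\mathbb H$, where $\epsilon\neq 0$, $\epsilon^2=0$, and $\epsilon$ commutes with all quaternions; the set of dual quaternions is $\hat{\mathbb H}$, and $q^*=q_s^*+q_d^*\epsilon$. For $A=(a_{ij})\in\hat{\mathbb H}^{n\times n}$, $A^*=(a_{ji}^* )$; $A$ is Hermitian if $A^*=A$. Multiplication matrix: $P_{i;\alpha}\in\hat{\mathbb H}^{n\times n}$ is the diagonal matrix whose $i$-th diagonal entry is $\alpha$ and whose other diagonal entries are $1$. Chen determinant: write a permutation $\sigma$ of $\{1,\dots,n\}$ as an ordered product of disjoint cycles (fixed points included) $$\sigma=(n_{11}\cdots n_{1l_1})(n_{21}\cdots n_{2l_2})\cdots(n_{r1}\cdots n_{rl_r}),$$ where $(i_1\cdots i_k)$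 means $i_1\mapsto i_2\mapsto\cdots\mapsto i_k\mapsto i_1$, arranged (uniquely) so that $n_{i1}>n_{ij}$ for all $j>1$ and $i=1,\dots,r$, and $n=n_{11}>n_{21}>\cdots>n_{r1}$. Set $$a_\sigma=(a_{n_{11}n_{12}}a_{n_{12}n_{13}}\cdots a_{n_{1l_1}n_{11}})(a_{n_{21}n_{22}}\cdots a_{n_{2l_2}n_{21}})\cdots(a_{n_{r1}n_{r2}}\cdots a_{n_{rl_r}n_{r1}})$$ (product in the indicated order). For an arbitrary (not necessarily Hermitian) $A=(a_{ij})\in\hat{\mathbb H}^{n\times n}$, $\mathrm{Cdet}(A)=\sum_\sigma(-1)^{n-r}a_\sigma$, summed over all permutations $\sigma$ of $\{1,\dots,n\}$, where $r$ is the number of cycles of $\sigma$. *)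

theory Defs
  imports "Jordan_Normal_Form.Matrix" "HOL-Combinatorics.Cycles"
begin

section \<open>Real quaternions\<close>

text \<open>\<open>Quat a b c d\<close> stands for \<open>a + b i + c j + d k\<close>, with \<open>i j = k\<close>.\<close>

datatype quat = Quat (qre: real) (qi: real) (qj: real) (qk: real)

instantiation quat :: ring_1
begin

definition "0 = Quat 0 0 0 0"

definition "1 = Quat 1 0 0 0"

definition "p + q = Quat (qre p + qre q) (qi p + qi q) (qj p + qj q) (qk p + qk q)"

definition "p - q = Quat (qre p - qre q) (qi p - qi q) (qj p - qj q) (qk p - qk q)"

definition "- q = Quat (- qre q) (- qi q) (- qj q) (- qk q)"

definition
  "p * q = Quat
    (qre p * qre q - qi p * qi q - qj p * qj q - qk p * qk q)
    (qre p * qi q + qi p * qre q + qj p * qk q - qk p * qj q)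
    (qre p * qj q - qi p * qk q + qj p * qre q + qk p * qi q)
    (qre p * qk q + qi p * qj q - qj p * qi q + qk p * qre q)"

instance
  by standard
    (simp_all add: zero_quat_def one_quat_def plus_quat_def minus_quat_def uminus_quat_def
      times_quat_def algebra_simps)

end

instantiation quat :: conjugate
begin

definition "conjugate q = Quat (qre q) (- qi q) (- qj q) (- qk q)"

instance
  by standard (auto simp: conjugate_quat_def intro: quat.expand)

end


section \<open>Dual quaternions\<close>

text \<open>\<open>DQuat s d\<close> stands for \<open>s + d \<epsilon>\<close>; the product encodes that \<open>\<epsilon>\<close> is central and
  \<open>\<epsilon>\<^sup>2 = 0\<close>.\<close>

datatype dquat = DQuat (std_part: quat) (dual_part: quat)

instantiation dquat :: ring_1
begin

definition "0 = DQuat 0 0"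

definition "1 = DQuat 1 0"

definition "p + q = DQuat (std_part p + std_part q) (dual_part p + dual_part q)"

definition "p - q = DQuat (std_part p - std_part q) (dual_part p - dual_part q)"

definition "- q = DQuat (- std_part q) (- dual_part q)"

definition
  "p * q = DQuat (std_part p * std_part q) (std_part p * dual_part q + dual_part p * std_part q)"

instance
  by standard
    (simp_all add: zero_dquat_def one_dquat_def plus_dquat_def minus_dquat_def uminus_dquat_def
      times_dquat_def algebra_simps)

end

instantiation dquat :: conjugate
begin

definition "conjugate q = DQuat (conjugate (std_part q)) (conjugate (dual_part q))"

instance
  by standard (auto simp: conjugate_dquat_def intro: dquat.expand)

end


section \<open>Matrices\<close>

text \<open>Matrices have rows and columns \<open>0, \<dots>, n - 1\<close>, so the index written \<open>i\<close> in the usual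
  \<open>1, \<dots>, n\<close> convention is \<open>i - 1\<close> here; in particular the last index is \<open>n - 1\<close>.\<close>

definition adj_mat :: "dquat mat \<Rightarrow> dquat mat"
  where "adj_mat A = transpose_mat (map_mat conjugate A)"

definition hermitian_mat :: "dquat mat \<Rightarrow> bool"
  where "hermitian_mat A \<longleftrightarrow> adj_mat A = A"

definition multiplication_mat :: "nat \<Rightarrow> nat \<Rightarrow> dquat \<Rightarrow> dquat mat"
  where "multiplication_mat n i \<alpha> =
    mat n n (\<lambda>(j, k). if j = k then (if j = i then \<alpha> else 1) else 0)"


section \<open>Chen determinant\<close>

text \<open>\<open>chen_form n \<sigma> cs\<close>: the list \<open>cs\<close> of cycles is the arrangement of \<open>\<sigma>\<close> as an ordered
  product of disjoint cycles (fixed points of \<open>{0..<n}\<close> included as cycles of length 1) in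
  which each cycle starts with its largest element and these leading elements decrease from
  left to right. The library's \<open>cycle_of_list\<close> sends each list element to the next one and
  the last one to the first.\<close>

definition chen_form :: "nat \<Rightarrow> (nat \<Rightarrow> nat) \<Rightarrow> nat list list \<Rightarrow> bool"
  where "chen_form n \<sigma> cs \<longleftrightarrow>
    distinct (concat cs) \<and> set (concat cs) = {0..<n} \<and>
    \<sigma> = foldr (\<circ>) (map cycle_of_list cs) id \<and>
    (\<forall>c\<in>set cs. c \<noteq> [] \<and> (\<forall>j\<in>set (tl c). j < hd c)) \<and>
    sorted_wrt (>) (map hd cs)"

text \<open>Existence and uniqueness, justifying the definite description below, are
  \<open>ex1_chen_form\<close>.\<close>

definition chen_cycles :: "nat \<Rightarrow> (nat \<Rightarrow> nat) \<Rightarrow> nat list list"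
  where "chen_cycles n \<sigma> = (THE cs. chen_form n \<sigma> cs)"

text \<open>For \<open>c = [i\<^sub>1, \<dots>, i\<^sub>k]\<close> this is \<open>a i\<^sub>1 i\<^sub>2 * a i\<^sub>2 i\<^sub>3 * \<dots> * a i\<^sub>k i\<^sub>1\<close>, in this order.\<close>

definition cycle_prod :: "dquat mat \<Rightarrow> nat list \<Rightarrow> dquat"
  where "cycle_prod A c = prod_list (map (($$) A) (zip c (rotate1 c)))"

definition Cdet :: "dquat mat \<Rightarrow> dquat"
  where "Cdet A = (let n = dim_row A in
    \<Sum>\<sigma> | \<sigma> permutes {0..<n}.
      (- 1) ^ (n - length (chen_cycles n \<sigma>)) * prod_list (map (cycle_prod A) (chen_cycles n \<sigma>)))"

lemma foldr_cycles_outside: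
  assumes "x \<notin> set (concat cs)"
  shows "foldr (\<circ>) (map cycle_of_list cs) id x = x"
  using assms by (induction cs) (auto simp: id_outside_supp)

lemma foldr_cycles_inside:
  assumes "distinct (concat cs)" "c \<in> set cs" "x \<in> set c"
  shows "foldr (\<circ>) (map cycle_of_list cs) id x = cycle_of_list c x"
  using assms
proof (induction cs)
  case (Cons d cs)
  have step: "foldr (\<circ>) (map cycle_of_list (d # cs)) id x =
      cycle_of_list d (foldr (\<circ>) (map cycle_of_list cs) id x)"
    by simp
  show ?case
  proof (cases "x \<in> set d")
    case True
    with Cons.prems have "x \<notin> set (concat cs)" by auto
    moreover have "c = d"
    proof (rule ccontr)
      assume "c \<noteq> d"
      with Cons.prems have "c \<in> set cs" by simp
      with Cons.prems \<open>x \<notin> set (concat cs)\<close> show False by auto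
    qed
    ultimately show ?thesis using step foldr_cycles_outside by metis
  next
    case False
    with Cons.prems have c: "c \<in> set cs" by auto
    have "distinct (concat cs)" using Cons.prems(1) by simp
    then have eq: "foldr (\<circ>) (map cycle_of_list cs) id x = cycle_of_list c x"
      using c Cons.prems(3) by (rule Cons.IH)
    have "cycle_of_list c x \<in> set c"
      using Cons.prems(3) cycle_permutes permutes_in_image by metis
    with c Cons.prems(1) have "cycle_of_list c x \<notin> set d" by auto
    then show ?thesis using step eq id_outside_supp by metis
  qed
qed simp

definition perm_cycle :: "(nat \<Rightarrow> nat) \<Rightarrow> nat \<Rightarrow> nat list"
  where "perm_cycle \<sigma> x = support \<sigma> x"

lemma chen_form_support:
  assumes "chen_form n \<sigma> cs" "c \<in> set cs"
  shows "perm_cycle \<sigma> (hd c) = c"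
proof -
  have dc: "distinct (concat cs)" and s: "\<sigma> = foldr (\<circ>) (map cycle_of_list cs) id"
    and ne: "c \<noteq> []"
    using assms by (auto simp: chen_form_def)
  have d: "distinct c"
    using dc assms(2) by (auto simp: distinct_concat_iff)
  have sig: "\<sigma> x = cycle_of_list c x" if "x \<in> set c" for x
    using foldr_cycles_inside[OF dc assms(2) that] unfolding s .
  have pow: "(\<sigma> ^^ k) x = (cycle_of_list c ^^ k) x \<and> (\<sigma> ^^ k) x \<in> set c" if "x \<in> set c" for x k
  proof (induction k)
    case (Suc k)
    then show ?case
      using sig cycle_permutes[of c] by (auto simp: permutes_in_image)
  qed (use that in simp)
  have nth: "(\<sigma> ^^ k) (hd c) = c ! (k mod length c)" for k
  proof -
    have "(\<sigma> ^^ k) (hd c) = hd (map (cycle_of_list c ^^ k) c)"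
      using pow[of "hd c"] ne by (simp add: hd_map)
    also have "\<dots> = hd (rotate k c)" using cyclic_rotation[OF d] by simp
    finally show ?thesis using ne by (simp add: hd_rotate_conv_nth)
  qed
  have "least_power \<sigma> (hd c) = length c"
    unfolding least_power_def
  proof (rule Least_equality)
    show "(\<sigma> ^^ length c) (hd c) = hd c \<and> length c > 0"
      using nth ne by (simp add: hd_conv_nth)
    fix k assume k: "(\<sigma> ^^ k) (hd c) = hd c \<and> k > 0"
    then have "c ! (k mod length c) = c ! 0" using nth ne by (simp add: hd_conv_nth)
    then have "k mod length c = 0" using d ne by (simp add: nth_eq_iff_index_eq)
    then show "length c \<le> k" using k by (metis mod_less not_less less_irrefl)
  qed
  then show ?thesis unfolding perm_cycle_def using nth by (intro nth_equalityI) auto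
qed

lemma self_in_support:
  assumes "permutation \<sigma>"
  shows "x \<in> set (perm_cycle \<sigma> x)"
  using least_power_of_permutation(2)[OF assms, of x] unfolding perm_cycle_def by force

lemma set_support_eq:
  assumes "permutation \<sigma>" "x \<in> set (perm_cycle \<sigma> y)"
  shows "set (perm_cycle \<sigma> x) = set (perm_cycle \<sigma> y)"
proof (rule ccontr)
  assume "set (perm_cycle \<sigma> x) \<noteq> set (perm_cycle \<sigma> y)"
  then have "set (perm_cycle \<sigma> x) \<inter> set (perm_cycle \<sigma> y) = {}"
    unfolding perm_cycle_def by (rule disjointD[OF disjoint_support[OF assms(1)] rangeI rangeI])
  moreover have "x \<in> set (perm_cycle \<sigma> x) \<inter> set (perm_cycle \<sigma> y)"
    by (rule IntI[OF self_in_support[OF assms(1)] assms(2)])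
  ultimately show False by (simp only: empty_iff)
qed

definition chen_leaders :: "nat \<Rightarrow> (nat \<Rightarrow> nat) \<Rightarrow> nat set"
  where "chen_leaders n \<sigma> = {x. x < n \<and> (\<forall>y\<in>set (perm_cycle \<sigma> x). y \<le> x)}"

lemma finite_chen_leaders [simp]: "finite (chen_leaders n \<sigma>)"
  by (simp add: chen_leaders_def)

lemma chen_form_heads:
  assumes "\<sigma> permutes {0..<n}" "chen_form n \<sigma> cs"
  shows "set (map hd cs) = chen_leaders n \<sigma>"
proof -
  have perm: "permutation \<sigma>" using assms(1) permutation_permutes by blast
  have le: "y \<le> hd c" if "c \<in> set cs" "y \<in> set c" for c y
    using assms(2) that by (cases c) (auto simp: chen_form_def dest!: bspec)
  have lt: "hd c < n" if "c \<in> set cs" for c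
  proof -
    have "c \<noteq> []" using assms(2) that by (simp add: chen_form_def)
    then have "hd c \<in> set (concat cs)" unfolding set_concat using that hd_in_set by blast
    then show ?thesis using assms(2) by (simp add: chen_form_def del: set_concat)
  qed
  show ?thesis
  proof (intro equalityI subsetI)
    fix x assume "x \<in> set (map hd cs)"
    then obtain c where c: "c \<in> set cs" "x = hd c" by auto
    then show "x \<in> chen_leaders n \<sigma>"
      using le lt chen_form_support[OF assms(2)] by (simp add: chen_leaders_def)
  next
    fix x assume x: "x \<in> chen_leaders n \<sigma>"
    then have "x \<in> set (concat cs)"
      using assms(2) by (simp add: chen_form_def chen_leaders_def del: set_concat)
    then obtain c where c: "c \<in> set cs" "x \<in> set c" by auto
    then have "x \<in> set (perm_cycle \<sigma> (hd c))" using chen_form_support[OF assms(2)] by simp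
    then have "set (perm_cycle \<sigma> x) = set (perm_cycle \<sigma> (hd c))" by (rule set_support_eq[OF perm])
    then have "hd c \<in> set (perm_cycle \<sigma> x)" using self_in_support[OF perm] by metis
    then have "hd c \<le> x" using x by (simp add: chen_leaders_def)
    with le[OF c] have "x = hd c" by simp
    with c show "x \<in> set (map hd cs)" by auto
  qed
qed

lemma chen_form_unique:
  assumes "\<sigma> permutes {0..<n}" "chen_form n \<sigma> cs"
  shows "cs = map (perm_cycle \<sigma>) (rev (sorted_list_of_set (chen_leaders n \<sigma>)))"
proof -
  have "sorted_wrt (<) (rev (map hd cs))"
    using assms(2) by (simp add: chen_form_def sorted_wrt_rev)
  moreover have "set (rev (map hd cs)) = chen_leaders n \<sigma>"
    using chen_form_heads[OF assms] by simp
  ultimately have "rev (map hd cs) = sorted_list_of_set (chen_leaders n \<sigma>)"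
    using strict_sorted_equal by (metis finite_chen_leaders set_sorted_list_of_set strict_sorted_list_of_set)
  then have "map hd cs = rev (sorted_list_of_set (chen_leaders n \<sigma>))" by (metis rev_rev_ident)
  moreover have "map (perm_cycle \<sigma>) (map hd cs) = cs"
    unfolding map_map by (rule map_idI) (simp add: chen_form_support[OF assms(2)])
  ultimately show ?thesis by simp
qed

lemma chen_form_exists:
  assumes "\<sigma> permutes {0..<n}"
  shows "chen_form n \<sigma> (map (perm_cycle \<sigma>) (rev (sorted_list_of_set (chen_leaders n \<sigma>))))"
    (is "chen_form n \<sigma> ?cs")
proof -
  let ?L = "chen_leaders n \<sigma>"
  have perm: "permutation \<sigma>" using assms permutation_permutes by blast
  have in_n: "y < n" if "x < n" "y \<in> set (perm_cycle \<sigma> x)" for x y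
    using that permutes_in_image[OF permutes_funpow[OF assms]] by (auto simp: perm_cycle_def)
  have set_cs: "set ?cs = perm_cycle \<sigma> ` ?L" by simp
  have disj: "x = y" if "x \<in> ?L" "y \<in> ?L" "set (perm_cycle \<sigma> x) \<inter> set (perm_cycle \<sigma> y) \<noteq> {}" for x y
  proof -
    have eq: "set (perm_cycle \<sigma> x) = set (perm_cycle \<sigma> y)"
      using that(3) set_support_eq[OF perm] by blast
    have "x \<in> set (perm_cycle \<sigma> y)" "y \<in> set (perm_cycle \<sigma> x)"
      using eq self_in_support[OF perm, of x] self_in_support[OF perm, of y] by simp_all
    then have "x \<le> y" "y \<le> x"
      using that(1,2) by (simp_all add: chen_leaders_def)
    then show ?thesis by simp
  qed
  have inj: "inj_on (perm_cycle \<sigma>) ?L"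
  proof (rule inj_onI)
    fix x y assume xy: "x \<in> ?L" "y \<in> ?L" "perm_cycle \<sigma> x = perm_cycle \<sigma> y"
    then have "set (perm_cycle \<sigma> x) \<inter> set (perm_cycle \<sigma> y) \<noteq> {}"
      using self_in_support[OF perm, of y] by (metis Int_absorb empty_iff)
    with xy disj show "x = y" by blast
  qed
  have dist: "distinct (concat ?cs)"
  proof (rule distinct_concat)
    show "distinct ?cs" using inj by (simp add: distinct_map)
  next
    fix c assume "c \<in> set ?cs"
    then show "distinct c" unfolding set_cs using cycle_of_permutation[OF perm] by (auto simp: perm_cycle_def)
  next
    fix c d assume "c \<in> set ?cs" "d \<in> set ?cs" "c \<noteq> d"
    then show "set c \<inter> set d = {}" unfolding set_cs using disj by blast
  qed
  have cover: "set (concat ?cs) = {0..<n}"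
  proof (intro equalityI subsetI)
    fix x assume "x \<in> set (concat ?cs)"
    then obtain y where "y \<in> ?L" "x \<in> set (perm_cycle \<sigma> y)" unfolding set_concat set_cs by blast
    then show "x \<in> {0..<n}" using in_n[of y x] by (simp add: chen_leaders_def)
  next
    fix x assume x: "x \<in> {0..<n}"
    define m where "m = Max (set (perm_cycle \<sigma> x))"
    have m: "m \<in> set (perm_cycle \<sigma> x)"
      unfolding m_def using self_in_support[OF perm, of x] by (intro Max_in) auto
    have eq: "set (perm_cycle \<sigma> m) = set (perm_cycle \<sigma> x)" by (rule set_support_eq[OF perm m])
    have "y \<le> m" if "y \<in> set (perm_cycle \<sigma> m)" for y
      using Max_ge[of "set (perm_cycle \<sigma> x)" y] that by (simp add: eq flip: m_def)
    moreover have "m < n" using in_n[OF _ m] x by simp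
    ultimately have "m \<in> ?L" unfolding chen_leaders_def by blast
    moreover have "x \<in> set (perm_cycle \<sigma> m)" using eq self_in_support[OF perm, of x] by simp
    ultimately show "x \<in> set (concat ?cs)" unfolding set_concat set_cs by blast
  qed
  have prod: "\<sigma> = foldr (\<circ>) (map cycle_of_list ?cs) id"
  proof
    fix x
    show "\<sigma> x = foldr (\<circ>) (map cycle_of_list ?cs) id x"
    proof (cases "x < n")
      case True
      then have "x \<in> set (concat ?cs)" unfolding cover by simp
      then obtain c where c: "c \<in> set ?cs" "x \<in> set c" unfolding set_concat by blast
      then obtain y where y: "c = perm_cycle \<sigma> y" unfolding set_cs by blast
      have "\<sigma> x = cycle_of_list c x"
        using cycle_restrict[OF perm, of x y] c(2) unfolding y perm_cycle_def .
      also have "\<dots> = foldr (\<circ>) (map cycle_of_list ?cs) id x"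
        by (rule foldr_cycles_inside[OF dist c, symmetric])
      finally show ?thesis .
    next
      case False
      then have "x \<notin> set (concat ?cs)" unfolding cover by simp
      then have "foldr (\<circ>) (map cycle_of_list ?cs) id x = x" by (rule foldr_cycles_outside)
      then show ?thesis using False permutes_not_in[OF assms] by simp
    qed
  qed
  have hd_support: "perm_cycle \<sigma> x \<noteq> []" "hd (perm_cycle \<sigma> x) = x" for x
    using least_power_of_permutation(2)[OF perm, of x] by (auto simp: perm_cycle_def hd_map)
  have lead: "c \<noteq> [] \<and> (\<forall>j\<in>set (tl c). j < hd c)" if c: "c \<in> set ?cs" for c
  proof -
    obtain x where x: "x \<in> ?L" "c = perm_cycle \<sigma> x" using c unfolding set_cs by blast
    have ne: "c \<noteq> []" and hd: "hd c = x" using hd_support by (simp_all add: x(2))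
    have "distinct c" unfolding x(2) perm_cycle_def by (rule cycle_of_permutation[OF perm])
    then have "x \<notin> set (tl c)" using ne hd by (cases c) auto
    moreover have "j \<le> x" if "j \<in> set (tl c)" for j
      using that x list.set_sel(2)[OF ne] by (simp add: chen_leaders_def)
    ultimately show ?thesis using ne hd by (metis le_neq_implies_less)
  qed
  have "map hd ?cs = rev (sorted_list_of_set ?L)"
    unfolding map_map by (rule map_idI) (simp only: comp_apply hd_support)
  then have "sorted_wrt (>) (map hd ?cs)"
    by (simp add: sorted_wrt_rev del: map_map)
  with dist cover prod lead show ?thesis unfolding chen_form_def by blast
qed

theorem ex1_chen_form:
  assumes "\<sigma> permutes {0..<n}"
  shows "\<exists>!cs. chen_form n \<sigma> cs"
  using chen_form_exists[OF assms] chen_form_unique[OF assms] by blast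

end

theory Submission
  imports Defs
begin

text \<open>
  The three identities are instances of one scaling law (\<open>Cdet_scale\<close>). Let \<open>B\<close> arise from the
  Hermitian matrix \<open>A\<close> by multiplying row \<open>i\<close> by \<open>l\<close> from the left and column \<open>i\<close> by \<open>r\<close>
  from the right, where \<open>l\<close> and \<open>r\<close> commute and either \<open>i\<close> is the last index or \<open>l * r\<close> is
  central. Then \<open>Cdet B = l * r * Cdet A\<close>. The pairs \<open>(l, r)\<close> in question are \<open>(\<alpha>, 1)\<close> and
  \<open>(1, \<alpha>)\<close> at the last index, and \<open>(\<alpha>\<^sup>*, \<alpha>)\<close> at any index, for which \<open>\<alpha>\<^sup>* \<alpha> = \<alpha> \<alpha>\<^sup>*\<close> is
  a dual number and hence central.

  The obstacle is that the scalar \<open>r\<close> at the end of a cycle product \<open>z\<close> cannot be moved to the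
  front. It can be moved past \<open>z + z\<^sup>*\<close>, which is a dual number (\<open>central_dquat_trace\<close>), and for
  Hermitian \<open>A\<close> the conjugate \<open>z\<^sup>*\<close> is the product over the reversed cycle
  (\<open>cycle_prod_reverse\<close>). Reversing the cycle through \<open>i\<close> is an involution on the permutations
  that preserves the leading element of each cycle, the order of the cycles and the sign. Hence
  twice the determinant is the sum of all terms with \<open>z\<close> replaced by \<open>z + z\<^sup>*\<close>
  (\<open>Cdet_double\<close>), and twice can be cancelled.

  In such a pair of terms there are two possibilities. If \<open>i\<close> leads its cycle, the pair
  contributes \<open>l * (z + z\<^sup>*) * r = l * r * (z + z\<^sup>*)\<close>. If not, \<open>r\<close> and \<open>l\<close> meet inside the
  cycle, as the factor \<open>r\<close> of the step entering \<open>i\<close> followed by the factor \<open>l\<close> of the step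
  leaving \<open>i\<close>; the last index always leads, so \<open>r * l = l * r\<close> is central here and comes out
  (\<open>cycle_prod_pair\<close>). It remains to move \<open>l * r\<close> to the left of the preceding cycles: there
  are none if \<open>i\<close> is the last index, and otherwise \<open>l * r\<close> is central (\<open>chen_term_pair\<close>).
\<close>

section \<open>Conjugation and central dual quaternions\<close>

definition central :: "'a::times \<Rightarrow> bool"
  where "central x \<longleftrightarrow> (\<forall>y. x * y = y * x)"

lemma central_commute: "central x \<Longrightarrow> x * y = y * x"
  by (simp add: central_def)

lemma central_one: "central (1 :: 'a::monoid_mult)"
  by (simp add: central_def)

lemma central_mult:
  fixes x y :: "'a::semigroup_mult"
  assumes "central x" "central y"
  shows "central (x * y)"
  using assms unfolding central_def by (metis mult.assoc)

lemma central_prod_list: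
  fixes xs :: "'a::monoid_mult list"
  shows "(\<And>x. x \<in> set xs \<Longrightarrow> central x) \<Longrightarrow> central (prod_list xs)"
  by (induction xs) (auto intro: central_one central_mult)

lemma central_minus_one_power: "central ((- 1) ^ m :: 'a::ring_1)"
  by (cases "even m") (simp_all add: central_def)

lemmas quat_arith = zero_quat_def one_quat_def plus_quat_def times_quat_def conjugate_quat_def
lemmas dquat_arith = zero_dquat_def one_dquat_def plus_dquat_def times_dquat_def conjugate_dquat_def

lemma dquat_conjugate_one: "conjugate (1 :: dquat) = 1"
  by (simp add: dquat_arith quat_arith)

lemma dquat_conjugate_mult:
  fixes x y :: dquat
  shows "conjugate (x * y) = conjugate y * conjugate x"
  by (simp add: dquat_arith quat_arith algebra_simps)

lemma dquat_conjugate_mult_commute: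
  fixes x :: dquat
  shows "conjugate x * x = x * conjugate x"
  by (simp add: dquat_arith quat_arith algebra_simps)

text \<open>Both \<open>x x\<^sup>*\<close> and \<open>x + x\<^sup>*\<close> are self-conjugate, and the self-conjugate dual
  quaternions are the dual numbers \<open>a + b \<epsilon>\<close> with real \<open>a\<close> and \<open>b\<close>.\<close>

lemma central_dquat_norm:
  fixes x :: dquat
  shows "central (x * conjugate x)"
  by (simp add: central_def dquat_arith quat_arith algebra_simps)

lemma central_dquat_trace:
  fixes x :: dquat
  shows "central (x + conjugate x)"
  by (simp add: central_def dquat_arith quat_arith algebra_simps)

lemma dquat_double_cancel:
  fixes x y :: dquat
  assumes "x + x = y + y"
  shows "x = y"
  using assms by (cases x; cases y) (auto simp: dquat_arith quat_arith intro!: quat.expand)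


section \<open>Products along walks\<close>

text \<open>A cycle product is the product along a closed walk. Open walks are the right generality for the
  inductions below, because unlike cycles they can be cut at a vertex.\<close>

fun walk_prod :: "dquat mat \<Rightarrow> nat list \<Rightarrow> dquat"
  where
    "walk_prod A (x # y # zs) = A $$ (x, y) * walk_prod A (y # zs)"
  | "walk_prod A _ = 1"

lemma walk_prod_append:
  "walk_prod A (xs @ v # ys) = walk_prod A (xs @ [v]) * walk_prod A (v # ys)"
  by (induction A xs rule: walk_prod.induct) (auto simp: mult.assoc neq_Nil_conv)

lemma cycle_prod_eq_walk_prod: "cycle_prod A (h # t) = walk_prod A (h # t @ [h])"
proof -
  have "prod_list (map (($$) A) (zip (x # t) (t @ [h]))) = walk_prod A (x # t @ [h])" for x
    by (induction t arbitrary: x) auto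
  then show ?thesis by (simp add: cycle_prod_def)
qed

lemma hermitian_mat_conjugate:
  assumes "A \<in> carrier_mat n n" "hermitian_mat A" "j < n" "k < n"
  shows "conjugate (A $$ (j, k)) = A $$ (k, j)"
proof -
  have "A $$ (k, j) = adj_mat A $$ (k, j)" using assms(2) by (simp add: hermitian_mat_def)
  also have "\<dots> = conjugate (A $$ (j, k))" using assms by (simp add: adj_mat_def)
  finally show ?thesis ..
qed

lemma walk_prod_rev:
  assumes "A \<in> carrier_mat n n" "hermitian_mat A" "set xs \<subseteq> {0..<n}"
  shows "walk_prod A (rev xs) = conjugate (walk_prod A xs)"
  using assms(3)
proof (induction xs)
  case (Cons x xs)
  show ?case
  proof (cases xs)
    case Nil
    then show ?thesis by (simp add: dquat_conjugate_one)
  next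
    case (Cons y zs)
    have "walk_prod A (rev (x # xs)) = walk_prod A (rev xs) * A $$ (y, x)"
      using walk_prod_append[of A "rev zs" y "[x]"] Cons by simp
    also have "\<dots> = conjugate (walk_prod A xs) * conjugate (A $$ (x, y))"
      using Cons.IH Cons.prems hermitian_mat_conjugate[OF assms(1,2), of x y] Cons by simp
    finally show ?thesis using Cons by (simp add: dquat_conjugate_mult)
  qed
qed (simp add: dquat_conjugate_one)

text \<open>The factors telescope: at an interior vertex \<open>v\<close> the factor \<open>g v\<close> of the step into \<open>v\<close> meets the
  factor \<open>f v\<close> of the step out of \<open>v\<close>, and since their product is central it can be collected
  in front. Only the factors at the two ends of the walk stay in place.\<close>

lemma walk_prod_scale:
  assumes entries: "\<And>j k. j < n \<Longrightarrow> k < n \<Longrightarrow> B $$ (j, k) = f j * A $$ (j, k) * g k"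
    and "\<And>v. v \<in> set t \<Longrightarrow> central (g v * f v)"
    and "x < n" "y < n" "set t \<subseteq> {0..<n}"
  shows "walk_prod B (x # t @ [y]) =
    prod_list (map (\<lambda>v. g v * f v) t) * (f x * walk_prod A (x # t @ [y]) * g y)"
  using assms(2-5)
proof (induction t arbitrary: x)
  case Nil
  then show ?case by (simp add: entries)
next
  case (Cons v t)
  let ?P = "prod_list (map (\<lambda>v. g v * f v) t)" and ?W = "walk_prod A (v # t @ [y])"
  let ?a = "A $$ (x, v)"
  have c: "central (g v * f v)" using Cons.prems by simp
  have P: "central ?P" using Cons.prems(1) by (intro central_prod_list) auto
  have "walk_prod B (x # (v # t) @ [y]) = f x * ?a * g v * (?P * (f v * ?W * g y))"
    using Cons by (simp add: entries)
  also have "\<dots> = f x * ?a * (g v * ?P) * (f v * ?W * g y)"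
    by (simp only: mult.assoc)
  also have "g v * ?P = ?P * g v" using central_commute[OF P] by simp
  also have "f x * ?a * (?P * g v) * (f v * ?W * g y)
      = (f x * ?a) * (?P * (g v * f v)) * (?W * g y)"
    by (simp only: mult.assoc)
  also have "(f x * ?a) * (?P * (g v * f v)) = (g v * f v) * ?P * (f x * ?a)"
    using central_commute[OF central_mult[OF P c]] central_commute[OF c] by simp
  finally show ?case by (simp add: mult.assoc)
qed

lemma prod_list_single_factor:
  fixes a :: "'a::monoid_mult"
  assumes "distinct t"
  shows "prod_list (map (\<lambda>v. if v = i then a else 1) t) = (if i \<in> set t then a else 1)"
  using assms by (induction t) auto


section \<open>Reversing a cycle\<close>

text \<open>The first entry stays in front, so that reversing a cycle written with its largest element
  first gives another one.\<close>

fun reverse_cycle :: "'a list \<Rightarrow> 'a list"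
  where
    "reverse_cycle [] = []"
  | "reverse_cycle (h # t) = h # rev t"

lemma reverse_cycle_simps [simp]:
  "set (reverse_cycle c) = set c"
  "distinct (reverse_cycle c) = distinct c"
  "reverse_cycle (reverse_cycle c) = c"
  "hd (reverse_cycle c) = hd c"
  "set (tl (reverse_cycle c)) = set (tl c)"
  "reverse_cycle c = [] \<longleftrightarrow> c = []"
  by (cases c; simp)+

text \<open>Reversing \<open>a\<^bsub>hj\<^esub> \<dots> a\<^bsub>kh\<^esub>\<close> reverses the order of the factors and replaces each by its conjugate,
  which is what conjugation does to a product.\<close>

lemma cycle_prod_reverse:
  assumes "A \<in> carrier_mat n n" "hermitian_mat A" "set c \<subseteq> {0..<n}"
  shows "cycle_prod A (reverse_cycle c) = conjugate (cycle_prod A c)"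
proof (cases c)
  case Nil
  then show ?thesis by (simp add: cycle_prod_def dquat_conjugate_one)
next
  case (Cons h t)
  then show ?thesis
    using walk_prod_rev[OF assms(1,2), of "h # t @ [h]"] assms(3)
    by (simp add: cycle_prod_eq_walk_prod)
qed

definition reverse_cycle_at :: "'a \<Rightarrow> 'a list list \<Rightarrow> 'a list list"
  where "reverse_cycle_at i = map (\<lambda>c. if i \<in> set c then reverse_cycle c else c)"


section \<open>The Chen determinant as a sum over cycle arrangements\<close>

text \<open>The conditions of \<open>chen_form\<close> that do not mention the permutation. They determine it, so the
  determinant can be summed over these lists, on which reversing a cycle is easy to describe.\<close>

definition chen_arrangements :: "nat \<Rightarrow> nat list list set"
  where "chen_arrangements n = {cs. distinct (concat cs) \<and> set (concat cs) = {0..<n} \<and>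
    (\<forall>c\<in>set cs. c \<noteq> [] \<and> (\<forall>j\<in>set (tl c). j < hd c)) \<and> sorted_wrt (>) (map hd cs)}"

definition chen_term :: "dquat mat \<Rightarrow> nat list list \<Rightarrow> dquat"
  where "chen_term A cs =
    (- 1) ^ (dim_row A - length cs) * prod_list (map (cycle_prod A) cs)"

lemma foldr_cycles_permutes:
  "foldr (\<circ>) (map cycle_of_list cs) id permutes set (concat cs)"
proof (induction cs)
  case (Cons c cs)
  have "cycle_of_list c permutes set (concat (c # cs))"
    by (rule permutes_subset[OF cycle_permutes]) simp
  moreover have "foldr (\<circ>) (map cycle_of_list cs) id permutes set (concat (c # cs))"
    by (rule permutes_subset[OF Cons.IH]) auto
  ultimately have "cycle_of_list c \<circ> foldr (\<circ>) (map cycle_of_list cs) id permutes set (concat (c # cs))"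
    by (rule permutes_compose[rotated])
  moreover have "foldr (\<circ>) (map cycle_of_list (c # cs)) id =
      cycle_of_list c \<circ> foldr (\<circ>) (map cycle_of_list cs) id"
    by simp
  ultimately show ?case by (simp only:)
qed (simp add: permutes_id[unfolded id_def] id_def)

lemma Cdet_eq_sum_arrangements:
  assumes "dim_row A = n"
  shows "Cdet A = (\<Sum>cs\<in>chen_arrangements n. chen_term A cs)"
  unfolding Cdet_def Let_def assms
proof (rule sum.reindex_bij_witness[where
      i = "\<lambda>cs. foldr (\<circ>) (map cycle_of_list cs) id" and j = "chen_cycles n"])
  fix \<sigma> assume "\<sigma> \<in> {\<sigma>. \<sigma> permutes {0..<n}}"
  then have "chen_form n \<sigma> (chen_cycles n \<sigma>)"
    unfolding chen_cycles_def using theI'[OF ex1_chen_form] by simp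
  then show "foldr (\<circ>) (map cycle_of_list (chen_cycles n \<sigma>)) id = \<sigma>"
    and "chen_cycles n \<sigma> \<in> chen_arrangements n"
    unfolding chen_form_def chen_arrangements_def by simp_all
  show "chen_term A (chen_cycles n \<sigma>) = (- 1) ^ (n - length (chen_cycles n \<sigma>)) *
      prod_list (map (cycle_prod A) (chen_cycles n \<sigma>))"
    by (simp add: chen_term_def assms)
next
  fix cs assume cs: "cs \<in> chen_arrangements n"
  let ?\<sigma> = "foldr (\<circ>) (map cycle_of_list cs) id"
  have "set (concat cs) = {0..<n}"
    using cs unfolding chen_arrangements_def by simp
  then have perm: "?\<sigma> permutes {0..<n}"
    using foldr_cycles_permutes[of cs] by simp
  then show "?\<sigma> \<in> {\<sigma>. \<sigma> permutes {0..<n}}" by simp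
  have "chen_form n ?\<sigma> cs"
    using cs unfolding chen_form_def chen_arrangements_def by simp
  then show "chen_cycles n ?\<sigma> = cs"
    unfolding chen_cycles_def using the1_equality[OF ex1_chen_form[OF perm]] by simp
qed

lemma set_concat_reverse_cycle_at: "set (concat (reverse_cycle_at i cs)) = set (concat cs)"
  by (induction cs) (auto simp: reverse_cycle_at_def)

lemma distinct_concat_reverse_cycle_at:
  "distinct (concat (reverse_cycle_at i cs)) = distinct (concat cs)"
proof (induction cs)
  case (Cons c cs)
  then show ?case
    using set_concat_reverse_cycle_at[of i cs] by (simp add: reverse_cycle_at_def)
qed (simp add: reverse_cycle_at_def)

lemma reverse_cycle_at_arrangement:
  assumes "cs \<in> chen_arrangements n"
  shows "reverse_cycle_at i cs \<in> chen_arrangements n"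
proof -
  have "map hd (reverse_cycle_at i cs) = map hd cs"
    by (auto simp: reverse_cycle_at_def)
  moreover have "\<forall>c\<in>set (reverse_cycle_at i cs). c \<noteq> [] \<and> (\<forall>j\<in>set (tl c). j < hd c)"
    using assms by (auto simp: reverse_cycle_at_def chen_arrangements_def)
  ultimately show ?thesis
    using assms unfolding chen_arrangements_def
    by (simp only: mem_Collect_eq set_concat_reverse_cycle_at distinct_concat_reverse_cycle_at)
qed

lemma reverse_cycle_at_involution: "reverse_cycle_at i (reverse_cycle_at i cs) = cs"
  by (simp add: reverse_cycle_at_def o_def map_idI)

text \<open>Reversing the cycle through \<open>i\<close> is a bijection of the arrangements, so it permutes the terms of
  the determinant.\<close>

lemma Cdet_double:
  assumes "dim_row A = n"
  shows "Cdet A + Cdet A =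
    (\<Sum>cs\<in>chen_arrangements n. chen_term A cs + chen_term A (reverse_cycle_at i cs))"
proof -
  have "(\<Sum>cs\<in>chen_arrangements n. chen_term A (reverse_cycle_at i cs)) =
      (\<Sum>cs\<in>chen_arrangements n. chen_term A cs)"
    by (rule sum.reindex_bij_witness[where i = "reverse_cycle_at i" and j = "reverse_cycle_at i"])
      (simp_all add: reverse_cycle_at_involution reverse_cycle_at_arrangement)
  then show ?thesis
    by (simp add: sum.distrib Cdet_eq_sum_arrangements[OF assms])
qed


section \<open>Scaling one row and one column\<close>

text \<open>The assumption \<open>last_or_central\<close> covers the two reasons for which \<open>l * r\<close> can be moved
  to the front of a term: no cycle stands before the one through \<open>i\<close>, or \<open>l * r\<close> is central.\<close>

locale row_column_scaling =
  fixes n i :: nat and A B :: "dquat mat" and l r :: dquat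
  assumes A: "A \<in> carrier_mat n n" and hermitian: "hermitian_mat A"
    and dim_B: "dim_row B = n" and i: "i < n"
    and entries: "\<And>j k. j < n \<Longrightarrow> k < n \<Longrightarrow>
      B $$ (j, k) = (if j = i then l else 1) * A $$ (j, k) * (if k = i then r else 1)"
    and commute: "l * r = r * l"
    and last_or_central: "i = n - 1 \<or> central (l * r)"
begin

text \<open>The walk around the cycle starts and ends at \<open>h\<close>. Thus the scalars \<open>l\<close> and \<open>r\<close> stay at the two
  ends if \<open>h = i\<close>, and meet in the interior if \<open>i\<close> is visited later.\<close>

lemma cycle_prod_scale:
  assumes "distinct (h # t)" "set (h # t) \<subseteq> {0..<n}" "i \<in> set t \<Longrightarrow> central (l * r)"
  shows "cycle_prod B (h # t) =
    (if h = i then l * cycle_prod A (h # t) * r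
     else if i \<in> set t then l * r * cycle_prod A (h # t) else cycle_prod A (h # t))"
proof -
  let ?f = "\<lambda>j. if j = i then l else 1" and ?g = "\<lambda>k. if k = i then r else 1"
  have fg: "?g v * ?f v = (if v = i then l * r else 1)" for v
    by (simp add: commute)
  have "walk_prod B (h # t @ [h]) =
      prod_list (map (\<lambda>v. ?g v * ?f v) t) * (?f h * walk_prod A (h # t @ [h]) * ?g h)"
  proof (rule walk_prod_scale[OF entries])
    show "central (?g v * ?f v)" if "v \<in> set t" for v
      using that assms(3) by (auto simp: commute central_one)
  qed (use assms(2) in auto)
  then show ?thesis
    using assms(1) by (auto simp: cycle_prod_eq_walk_prod fg prod_list_single_factor)
qed

lemma cycle_prod_unchanged:
  assumes "distinct c" "set c \<subseteq> {0..<n}" "i \<notin> set c"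
  shows "cycle_prod B c = cycle_prod A c"
proof (cases c)
  case Nil
  then show ?thesis by (simp add: cycle_prod_def)
next
  case (Cons h t)
  then show ?thesis using assms cycle_prod_scale[of h t] by auto
qed

text \<open>When \<open>i\<close> leads the cycle, a single cycle product need not commute with \<open>r\<close>; the sum with
  the reversed cycle does, being of the form \<open>z + z\<^sup>*\<close>.\<close>

lemma cycle_prod_pair:
  assumes "distinct c" "set c \<subseteq> {0..<n}" "i \<in> set c" "i \<in> set (tl c) \<Longrightarrow> central (l * r)"
  shows "cycle_prod B c + cycle_prod B (reverse_cycle c) =
    l * r * (cycle_prod A c + cycle_prod A (reverse_cycle c))"
proof -
  obtain h t where c: "c = h # t" using assms(3) by (cases c) auto
  let ?S = "cycle_prod A c + cycle_prod A (reverse_cycle c)"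
  have B: "cycle_prod B c = (if h = i then l * cycle_prod A c * r else l * r * cycle_prod A c)"
    "cycle_prod B (reverse_cycle c) = (if h = i then l * cycle_prod A (reverse_cycle c) * r
      else l * r * cycle_prod A (reverse_cycle c))"
    using assms cycle_prod_scale[of h t] cycle_prod_scale[of h "rev t"] unfolding c by auto
  have "central ?S"
    using central_dquat_trace cycle_prod_reverse[OF A hermitian assms(2)] by simp
  then have "l * ?S * r = l * r * ?S"
    by (simp only: mult.assoc central_commute)
  then show ?thesis using B by (simp add: distrib_left distrib_right)
qed

text \<open>Only the cycle through \<open>i\<close> is affected by the scaling, and by reversal. Its pair yields the factor
  \<open>l * r\<close>, which then has to pass the cycles in front.\<close>

lemma chen_term_pair:
  assumes cs: "cs \<in> chen_arrangements n"
  shows "chen_term B cs + chen_term B (reverse_cycle_at i cs) =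
    l * r * (chen_term A cs + chen_term A (reverse_cycle_at i cs))"
proof -
  have dist: "distinct (concat cs)" and set: "set (concat cs) = {0..<n}"
    and lead: "\<And>c j. c \<in> set cs \<Longrightarrow> j \<in> set (tl c) \<Longrightarrow> j < hd c"
    and ne: "\<And>c. c \<in> set cs \<Longrightarrow> c \<noteq> []"
    and sorted: "sorted_wrt (>) (map hd cs)"
    using cs unfolding chen_arrangements_def by blast+
  obtain c where "c \<in> set cs" "i \<in> set c"
    using i set by (metis UN_iff atLeastLessThan_iff le0 set_concat)
  then obtain xs ys where split: "cs = xs @ c # ys" by (meson split_list)
  have sub: "set d \<subseteq> {0..<n}" and dd: "distinct d" if "d \<in> set cs" for d
    using that set dist by (auto simp: distinct_concat_iff)
  have hd_less: "hd d < n" if "d \<in> set cs" for d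
    using sub[OF that] hd_in_set[OF ne[OF that]] by auto
  have notin: "i \<notin> set d" if "d \<in> set xs \<union> set ys" for d
    using dist that \<open>i \<in> set c\<close> unfolding split by auto
  have flip: "reverse_cycle_at i cs = xs @ reverse_cycle c # ys"
    using notin \<open>i \<in> set c\<close> by (auto simp: split reverse_cycle_at_def intro!: map_idI)
  have same: "map (cycle_prod B) xs = map (cycle_prod A) xs"
    "map (cycle_prod B) ys = map (cycle_prod A) ys"
    using notin sub dd by (auto simp: split intro!: cycle_prod_unchanged)
  have pair: "cycle_prod B c + cycle_prod B (reverse_cycle c) =
      l * r * (cycle_prod A c + cycle_prod A (reverse_cycle c))"
  proof (rule cycle_prod_pair)
    assume "i \<in> set (tl c)"
    then have "i < hd c" using lead \<open>c \<in> set cs\<close> by blast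
    then show "central (l * r)" using last_or_central hd_less[OF \<open>c \<in> set cs\<close>] by auto
  qed (use sub dd \<open>c \<in> set cs\<close> \<open>i \<in> set c\<close> in auto)
  let ?e = "(- 1) ^ (n - length cs) :: dquat"
  let ?X = "prod_list (map (cycle_prod A) xs)" and ?Y = "prod_list (map (cycle_prod A) ys)"
  \<comment> \<open>The leaders decrease, so a cycle containing the last index comes first.\<close>
  have X: "?X * (l * r) = l * r * ?X"
  proof (cases "central (l * r)")
    case True
    then show ?thesis by (rule central_commute[symmetric])
  next
    case False
    then have last: "i = n - 1" using last_or_central by simp
    have "i \<le> hd c" using \<open>i \<in> set c\<close> lead[OF \<open>c \<in> set cs\<close>, of i] by (cases c) auto
    have "xs = []"
    proof (rule ccontr)
      assume "xs \<noteq> []"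
      then obtain d where "d \<in> set xs" by (cases xs) auto
      then have "hd c < hd d" using sorted by (auto simp: split sorted_wrt_append)
      moreover have "hd d < n" using hd_less \<open>d \<in> set xs\<close> by (simp add: split)
      ultimately show False using \<open>i \<le> hd c\<close> last by simp
    qed
    then show ?thesis by simp
  qed
  have dim_A: "dim_row A = n" using A by simp
  have "chen_term B cs + chen_term B (reverse_cycle_at i cs) =
      ?e * (?X * ((cycle_prod B c + cycle_prod B (reverse_cycle c)) * ?Y))"
    unfolding flip by (simp add: chen_term_def split same dim_B distrib_left distrib_right)
  also have "\<dots> = ?e * ((?X * (l * r)) * ((cycle_prod A c + cycle_prod A (reverse_cycle c)) * ?Y))"
    by (simp only: pair mult.assoc)
  also have "\<dots> = (?e * (l * r)) * (?X * ((cycle_prod A c + cycle_prod A (reverse_cycle c)) * ?Y))"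
    by (simp only: X mult.assoc)
  also have "?e * (l * r) = l * r * ?e"
    by (rule central_commute[OF central_minus_one_power])
  also have "l * r * ?e * (?X * ((cycle_prod A c + cycle_prod A (reverse_cycle c)) * ?Y)) =
      l * r * (chen_term A cs + chen_term A (reverse_cycle_at i cs))"
    unfolding flip by (simp add: chen_term_def split dim_A distrib_left distrib_right mult.assoc)
  finally show ?thesis .
qed

lemma Cdet_scale: "Cdet B = l * r * Cdet A"
proof (rule dquat_double_cancel)
  have "Cdet B + Cdet B =
      l * r * (\<Sum>cs\<in>chen_arrangements n. chen_term A cs + chen_term A (reverse_cycle_at i cs))"
    unfolding Cdet_double[OF dim_B, of i] sum_distrib_left
    by (intro sum.cong refl chen_term_pair)
  also have "\<dots> = l * r * (Cdet A + Cdet A)"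
    using Cdet_double[of A n i] A by simp
  finally show "Cdet B + Cdet B = l * r * Cdet A + l * r * Cdet A"
    by (simp add: distrib_left)
qed

end


section \<open>Multiplication matrices\<close>

lemma multiplication_mat_carrier: "multiplication_mat n i \<alpha> \<in> carrier_mat n n"
  by (simp add: multiplication_mat_def)

lemma adj_multiplication_mat:
  "adj_mat (multiplication_mat n i \<alpha>) = multiplication_mat n i (conjugate \<alpha>)"
proof -
  have "conjugate (0 :: dquat) = 0" by (simp add: dquat_arith quat_arith)
  then show ?thesis
    by (intro eq_matI) (auto simp: adj_mat_def multiplication_mat_def dquat_conjugate_one)
qed

lemma multiplication_mat_times:
  assumes "M \<in> carrier_mat n n" "j < n" "k < n"
  shows "(multiplication_mat n i \<alpha> * M) $$ (j, k) = (if j = i then \<alpha> else 1) * M $$ (j, k)"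
proof -
  have "(multiplication_mat n i \<alpha> * M) $$ (j, k) =
      (\<Sum>m = 0..<n. multiplication_mat n i \<alpha> $$ (j, m) * M $$ (m, k))"
    using assms by (simp add: multiplication_mat_def scalar_prod_def)
  also have "\<dots> = (\<Sum>m = 0..<n. if m = j then (if j = i then \<alpha> else 1) * M $$ (j, k) else 0)"
    using assms by (intro sum.cong refl) (simp add: multiplication_mat_def)
  finally show ?thesis using assms by simp
qed

lemma times_multiplication_mat:
  assumes "M \<in> carrier_mat n n" "j < n" "k < n"
  shows "(M * multiplication_mat n i \<alpha>) $$ (j, k) = M $$ (j, k) * (if k = i then \<alpha> else 1)"
proof -
  have "(M * multiplication_mat n i \<alpha>) $$ (j, k) =
      (\<Sum>m = 0..<n. M $$ (j, m) * multiplication_mat n i \<alpha> $$ (m, k))"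
    using assms by (simp add: multiplication_mat_def scalar_prod_def)
  also have "\<dots> = (\<Sum>m = 0..<n. if m = k then M $$ (j, k) * (if k = i then \<alpha> else 1) else 0)"
    using assms by (intro sum.cong refl) (simp add: multiplication_mat_def)
  finally show ?thesis using assms by simp
qed

theorem lemma3p3:
  fixes n :: nat and A :: "dquat mat" and \<alpha> :: dquat
  assumes "n \<ge> 1"
    and "A \<in> carrier_mat n n"
    and "hermitian_mat A"
  shows "Cdet (multiplication_mat n (n - 1) \<alpha> * A) = \<alpha> * Cdet A \<and>
    Cdet (A * multiplication_mat n (n - 1) \<alpha>) = \<alpha> * Cdet A \<and>
    (\<forall>i<n. Cdet (adj_mat (multiplication_mat n i \<alpha>) * A * multiplication_mat n i \<alpha>)
      = conjugate \<alpha> * \<alpha> * Cdet A)"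
proof (intro conjI allI impI)
  have P: "dim_row (multiplication_mat n i \<beta>) = n" for i \<beta>
    by (simp add: multiplication_mat_def)
  show "Cdet (multiplication_mat n (n - 1) \<alpha> * A) = \<alpha> * Cdet A"
  proof -
    interpret row_column_scaling n "n - 1" A "multiplication_mat n (n - 1) \<alpha> * A" \<alpha> 1
      by unfold_locales (use assms in \<open>auto simp: P central_one multiplication_mat_times simp del: index_mult_mat(1)\<close>)
    show ?thesis using Cdet_scale by simp
  qed
  show "Cdet (A * multiplication_mat n (n - 1) \<alpha>) = \<alpha> * Cdet A"
  proof -
    interpret row_column_scaling n "n - 1" A "A * multiplication_mat n (n - 1) \<alpha>" 1 \<alpha>
      by unfold_locales (use assms in \<open>auto simp: central_one times_multiplication_mat simp del: index_mult_mat(1)\<close>)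
    show ?thesis using Cdet_scale by simp
  qed
  fix i assume i: "i < n"
  let ?B = "multiplication_mat n i (conjugate \<alpha>) * A * multiplication_mat n i \<alpha>"
  have PA: "multiplication_mat n i (conjugate \<alpha>) * A \<in> carrier_mat n n"
    using multiplication_mat_carrier assms(2) by (rule mult_carrier_mat)
  interpret row_column_scaling n i A ?B "conjugate \<alpha>" \<alpha>
  proof unfold_locales
    fix j k assume "j < n" "k < n"
    then show "?B $$ (j, k) =
        (if j = i then conjugate \<alpha> else 1) * A $$ (j, k) * (if k = i then \<alpha> else 1)"
      by (simp only: times_multiplication_mat[OF PA] multiplication_mat_times[OF assms(2)])
  qed (use assms i in \<open>simp_all add: P dquat_conjugate_mult_commute central_dquat_norm\<close>)
  show "Cdet (adj_mat (multiplication_mat n i \<alpha>) * A * multiplication_mat n i \<alpha>)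
      = conjugate \<alpha> * \<alpha> * Cdet A"
    unfolding adj_multiplication_mat by (rule Cdet_scale)
qed

end
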